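(* Let $\sigma_n(x,f)$ be the Fejér means of the Fourier series of a function $f\in L^1(\mathbb T)$ and let $\theta_n$ be a sequence of real numbers with $\theta_n=O(1/n)$. Then $\sigma_n(x+\theta_n,f)\to f(x)$ as $n\to\infty$ at any Lebesgue point $x\in\mathbb T$ of $f$.
   Context: $\mathbb T=\mathbb R/2\pi\mathbb Z$. A point $x$ is a Lebesgue point of $f$ if $\lim_{h\to0}\frac1{2h}\int_{x-h}^{x+h}|f(u)-f(x)|\,du=0$. The Fejér means are the arithmetic (Cesàro) means of the partial sums of the trigonometric Fourier series of $f$. *)

theory Defs
  imports "HOL-Analysis.Analysis" "HOL-Library.Landau_Symbols"
begin

text \<open>
  Functions on the torus \<open>\<real>/2\<pi>\<int>\<close> are represented by \<open>2\<pi>\<close>-periodic functions on the real line.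
  Integrals are taken with respect to \<^const>\<open>lebesgue\<close>, so that representatives need not be Borel
  measurable. Elements of \<open>L1_torus\<close> are functions, not classes modulo null sets: the value
  at a given point matters for the notion of a Lebesgue point.
\<close>

definition L1_torus :: "(real \<Rightarrow> complex) set" where
  "L1_torus = {f. (\<forall>x. f (x + 2 * pi) = f x) \<and> f absolutely_integrable_on {-pi..pi}}"

definition fourier_coeff :: "(real \<Rightarrow> complex) \<Rightarrow> int \<Rightarrow> complex" where
  "fourier_coeff f k =
     (1 / (2 * pi)) *\<^sub>R (LINT t:{-pi..pi}|lebesgue. f t * cis (- (of_int k * t)))"

definition fourier_partial_sum :: "(real \<Rightarrow> complex) \<Rightarrow> nat \<Rightarrow> real \<Rightarrow> complex" where
  "fourier_partial_sum f n x = (\<Sum>k\<in>{- int n..int n}. fourier_coeff f k * cis (of_int k * x))"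

definition fejer_mean :: "nat \<Rightarrow> real \<Rightarrow> (real \<Rightarrow> complex) \<Rightarrow> complex" where
  "fejer_mean n x f = (\<Sum>k=0..n. fourier_partial_sum f k x) / of_nat (n + 1)"

text \<open>
  The limit is two-sided; for \<open>h < 0\<close> the interval integral is the oriented one, so the
  averages for \<open>h\<close> and \<open>-h\<close> coincide.
\<close>

definition lebesgue_point :: "(real \<Rightarrow> complex) \<Rightarrow> real \<Rightarrow> bool" where
  "lebesgue_point f x \<longleftrightarrow>
     ((\<lambda>h. 1 / (2 * h) * (LINT u=ereal (x - h)..ereal (x + h)|lebesgue. norm (f u - f x)))
        \<longlongrightarrow> 0) (at 0)"

end

theory Submission
  imports Defs
begin

text \<open>
  Two facts about the Fejer kernel \<open>F\<^sub>n\<close> are used: it has mean value 1 (\<open>fejer_mean_const\<close>),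
  and with \<open>N = n + 1\<close> it satisfies \<open>\<bar>F\<^sub>n(s)\<bar> \<le> min(N, 36 / (N s\<^sup>2))\<close> for \<open>\<bar>s\<bar> \<le> 4\<close>, a range
  larger than the period \<open>[-\<pi>, \<pi>]\<close> (\<open>norm_fejer_kernel_le\<close>, \<open>norm_fejer_kernel_decay\<close>). By the first,
  \<open>\<sigma>\<^sub>n(x + \<theta>\<^sub>n) - f(x)\<close> is the average over a period around \<open>x\<close> of
  \<open>(f(t) - f(x)) F\<^sub>n(x + \<theta>\<^sub>n - t)\<close>.

  The perturbation \<open>\<theta>\<^sub>n\<close> is of the order of the width \<open>1/N\<close> of the peak of \<open>F\<^sub>n\<close>, so the translated
  kernel, viewed from the unperturbed centre \<open>x\<close>, obeys bounds of the same shape with a larger constant: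
  if \<open>N \<bar>\<theta>\<bar> \<le> A\<close>, then multiplying \<open>s\<^sup>2 \<le> 2\<theta>\<^sup>2 + 2(\<theta> - s)\<^sup>2\<close> by \<open>N \<bar>F\<^sub>n(\<theta> - s)\<bar>\<close>
  and using the first kernel bound on one term and the second on the other
  gives \<open>N s\<^sup>2 \<bar>F\<^sub>n(\<theta> - s)\<bar> \<le> 2A\<^sup>2 + 72\<close> (\<open>norm_fejer_kernel_translate\<close>).

  It remains to see that kernels bounded by \<open>C min(N, 1/(N s\<^sup>2))\<close> annihilate, in the limit, a function whose
  absolute value has means tending to 0 over shrinking centred intervals (\<open>tendsto_integral_kernel\<close>). The majorant is itself
  dominated by the multiples \<open>4CN/4\<^sup>j\<close> of the indicators of \<open>\<bar>s\<bar> \<le> 2\<^sup>j/N\<close>; if the integral of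
  \<open>\<bar>f(t) - f(x)\<bar>\<close> over \<open>[x - \<rho>, x + \<rho>]\<close> is at most \<open>\<epsilon>\<rho>\<close>, then the \<open>j\<close>-th dyadic interval
  contributes at most \<open>4C\<epsilon>/2\<^sup>j\<close>, which is summable in \<open>j\<close> uniformly in \<open>N\<close>. Away from \<open>x\<close>
  the kernel is \<open>O(1/N)\<close> and integrability suffices.
\<close>

section \<open>Integrals of periodic functions\<close>

text \<open>
  Translates of one integrable period are integrable, and finitely many of them cover any compact
  interval; they are joined first to the right, then to the left.
\<close>

lemma integrable_on_periodic:
  fixes f :: "real \<Rightarrow> 'a::banach"
  assumes per: "\<And>x. f (x + p) = f x" and p: "p > 0" and f: "f integrable_on {c..c + p}"
  shows "f integrable_on {a..b}"
proof -
  have shift: "f integrable_on {a..b} \<longleftrightarrow> f integrable_on {a + p..b + p}" for a b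
    using integrable_on_shift_Icc_real[of f p a b] per by (simp add: o_def add.commute)
  have right: "f integrable_on {c..c + real k * p}" for k
  proof (induction k)
    case (Suc k)
    have "f integrable_on {c + p..c + real k * p + p}"
      using Suc shift by blast
    then have "f integrable_on {c..c + real k * p + p}"
      by (intro Henstock_Kurzweil_Integration.integrable_combine[OF _ _ f]) (use p in auto)
    then show ?case
      by (simp add: algebra_simps)
  qed (use integrable_on_refl[of f c] in simp)
  have both: "f integrable_on {c - real j * p..c + real k * p}" for j k
  proof (induction j arbitrary: k)
    case 0
    then show ?case using right by simp
  next
    case (Suc j)
    have "f integrable_on {c - real (Suc j) * p + p..c + real k * p + p}"
      using Suc[of "Suc k"] by (simp add: algebra_simps)
    then show ?case using shift by blast
  qed
  obtain j k where "(c - a) / p \<le> real j" "(b - c) / p \<le> real k"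
    using real_arch_simple by meson
  then have "{a..b} \<subseteq> {c - real j * p..c + real k * p}"
    using p by (auto simp: field_simps)
  then show ?thesis
    using both integrable_on_subinterval by blast
qed

lemma absolutely_integrable_on_periodic:
  fixes f :: "real \<Rightarrow> 'a::euclidean_space"
  assumes "\<And>x. f (x + p) = f x" "p > 0" "f absolutely_integrable_on {c..c + p}"
  shows "f absolutely_integrable_on {a..b}"
  using assms integrable_on_periodic[of f p c a b] integrable_on_periodic[of "\<lambda>x. norm (f x)" p c a b]
  by (simp add: absolutely_integrable_on_def)

lemma integral_periodic:
  fixes f :: "real \<Rightarrow> 'a::banach"
  assumes per: "\<And>x. f (x + p) = f x" and p: "p > 0" and f: "f integrable_on {c..c + p}"
  shows "integral {a..a + p} f = integral {b..b + p} f"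
proof -
  have *: "integral {a..a + p} f = integral {b..b + p} f" if "a \<le> b" for a b
  proof -
    \<comment> \<open>Both sides are the integral over \<open>[a, b + p]\<close>, split at \<open>b\<close> and at \<open>a + p\<close>.\<close>
    have "integral {a..b} f + integral {b..b + p} f = integral {a..a + p} f + integral {a + p..b + p} f"
      using integrable_on_periodic[OF assms] that p
      by (simp add: Henstock_Kurzweil_Integration.integral_combine)
    moreover have "integral {a + p..b + p} f = integral {a..b} f"
      using integral_shift_Icc_real[of a b f p] per by (simp add: o_def add.commute)
    ultimately show ?thesis by simp
  qed
  show ?thesis
    by (metis * linear)
qed

section \<open>Size of the Fejer kernel\<close>

definition fejer_kernel :: "nat \<Rightarrow> real \<Rightarrow> complex" where
  "fejer_kernel n s = (\<Sum>k=0..n. \<Sum>j\<in>{- int k..int k}. cis (of_int j * s)) / of_nat (n + 1)"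

lemma sum_symmetric_int_Suc:
  fixes g :: "int \<Rightarrow> 'a::comm_monoid_add"
  shows "(\<Sum>j\<in>{- int (Suc k)..int (Suc k)}. g j) =
    g (int (Suc k)) + (g (- int (Suc k)) + (\<Sum>j\<in>{- int k..int k}. g j))"
proof -
  have "{- int (Suc k)..int (Suc k)} = insert (int (Suc k)) (insert (- int (Suc k)) {- int k..int k})"
    by auto
  then show ?thesis by simp
qed

text \<open>
  Multiplying by \<open>cis s - 1\<close> makes the geometric sum telescope. Keeping the factor on the left, here and in the
  next lemma, avoids a case distinction at the multiples of \<open>2\<pi>\<close>.
\<close>

lemma dirichlet_kernel_mult:
  "(\<Sum>j\<in>{- int k..int k}. cis (of_int j * s)) * (cis s - 1) =
     cis (of_nat (k + 1) * s) - cis (- (of_nat k * s))"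
proof (induction k)
  case (Suc k)
  show ?case
    unfolding sum_symmetric_int_Suc distrib_right Suc
    by (simp add: algebra_simps cis_mult)
qed auto

text \<open>
  The arithmetic mean of the Dirichlet kernels telescopes a second time, against \<open>1 - cis (-s)\<close>. The product
  of the two factors has modulus \<open>4 sin\<^sup>2 (s/2)\<close> while the right-hand side stays bounded by 4; this is the source of
  the quadratic decay of the kernel.
\<close>

lemma fejer_kernel_mult:
  "of_nat (n + 1) * fejer_kernel n s * ((cis s - 1) * (1 - cis (- s))) =
     cis (of_nat (n + 1) * s) + cis (- (of_nat (n + 1) * s)) - 2"
proof -
  have "(\<Sum>k=0..n. \<Sum>j\<in>{- int k..int k}. cis (of_int j * s)) * ((cis s - 1) * (1 - cis (- s))) =
     cis (of_nat (n + 1) * s) + cis (- (of_nat (n + 1) * s)) - 2"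
  proof (induction n)
    case 0
    show ?case by (simp add: algebra_simps cis_mult)
  next
    case (Suc n)
    have "(\<Sum>j\<in>{- int (Suc n)..int (Suc n)}. cis (of_int j * s)) * ((cis s - 1) * (1 - cis (- s))) =
       (cis (of_nat (Suc n + 1) * s) - cis (- (of_nat (Suc n) * s))) * (1 - cis (- s))"
      by (simp only: dirichlet_kernel_mult flip: mult.assoc)
    also have "\<dots> = cis (of_nat (Suc n + 1) * s) + cis (- (of_nat (Suc n + 1) * s))
        - (cis (of_nat (n + 1) * s) + cis (- (of_nat (n + 1) * s)))"
      by (simp add: algebra_simps cis_mult minus_diff_commute)
    finally show ?case
      using Suc.IH unfolding sum.atLeast0_atMost_Suc distrib_right by simp
  qed
  then show ?thesis
    by (simp add: fejer_kernel_def of_nat_eq_0_iff del: of_nat_Suc of_nat_add)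
qed

lemma norm_fejer_kernel_le: "norm (fejer_kernel n s) \<le> real (n + 1)"
proof -
  have "norm (\<Sum>k=0..n. \<Sum>j\<in>{- int k..int k}. cis (of_int j * s))
      \<le> (\<Sum>k=0..n. \<Sum>j\<in>{- int k..int k}. 1)"
    by (intro sum_norm_le) (auto intro!: sum_norm_le)
  also have "\<dots> = real (n + 1) * real (n + 1)"
    by (induction n) (auto simp: algebra_simps)
  finally show ?thesis
    by (simp add: fejer_kernel_def norm_divide divide_le_eq del: of_nat_Suc of_nat_add)
qed

lemma norm_cis_minus_1: "norm (cis s - 1) = 2 * \<bar>sin (s / 2)\<bar>"
proof -
  have "cis s - 1 = cis (s / 2) * (2 * \<i> * of_real (sin (s / 2)))"
  proof -
    have "cis s - 1 = cis (s / 2) * (cis (s / 2) - cis (- (s / 2)))"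
      by (simp add: right_diff_distrib cis_mult)
    also have "cis (s / 2) - cis (- (s / 2)) = 2 * \<i> * of_real (sin (s / 2))"
      by (simp add: complex_eq_iff)
    finally show ?thesis .
  qed
  then show ?thesis by (simp add: norm_mult)
qed

lemma norm_fejer_kernel_sin_le: "real (n + 1) * (sin (s / 2))\<^sup>2 * norm (fejer_kernel n s) \<le> 1"
proof -
  have "norm (1 - cis (- s)) = 2 * \<bar>sin (s / 2)\<bar>"
    using norm_cis_minus_1[of "- s"] by (simp add: norm_minus_commute)
  then have "real (n + 1) * norm (fejer_kernel n s) * (4 * (sin (s / 2))\<^sup>2) =
      norm (of_nat (n + 1) * fejer_kernel n s * ((cis s - 1) * (1 - cis (- s))))"
    by (simp add: norm_mult norm_cis_minus_1 power2_eq_square del: of_nat_Suc of_nat_add)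
  also have "\<dots> = norm (cis (of_nat (n + 1) * s) + cis (- (of_nat (n + 1) * s)) - 2)"
    by (simp only: fejer_kernel_mult)
  also have "\<dots> \<le> norm (cis (of_nat (n + 1) * s)) + norm (cis (- (of_nat (n + 1) * s))) + norm (2::complex)"
    by (meson norm_triangle_ineq norm_triangle_ineq4 order_trans add_right_mono)
  finally show ?thesis by (simp add: algebra_simps)
qed

text \<open>
  This follows from \<open>\<bar>sin u - u\<bar> \<le> \<bar>u\<bar>\<^sup>3/6\<close>. The range \<open>\<bar>u\<bar> \<le> 2\<close> is chosen larger than
  \<open>\<pi>/2\<close>: the argument \<open>u = s/2\<close> of the kernel bound leaves \<open>[-\<pi>/2, \<pi>/2]\<close> slightly once \<open>s\<close> is a point
  of the period shifted by \<open>\<theta>\<close>.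
\<close>

lemma abs_sin_ge_third:
  fixes u :: real
  assumes "\<bar>u\<bar> \<le> 2"
  shows "\<bar>u\<bar> / 3 \<le> \<bar>sin u\<bar>"
proof -
  have "\<bar>sin u - (\<Sum>m<3. sin_coeff m * u ^ m)\<bar> \<le> inverse (fact 3) * \<bar>u\<bar> ^ 3"
    by (rule Maclaurin_sin_bound)
  then have "\<bar>sin u - u\<bar> \<le> \<bar>u\<bar> ^ 3 / 6"
    by (simp add: eval_nat_numeral sin_coeff_def)
  moreover have "\<bar>u\<bar> ^ 3 \<le> 2\<^sup>2 * \<bar>u\<bar>"
    using assms mult_right_mono[OF power_mono[OF assms abs_ge_zero, of 2] abs_ge_zero[of u]]
    by (simp add: power3_eq_cube power2_eq_square)
  ultimately show ?thesis by (simp add: abs_if split: if_splits)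
qed

lemma norm_fejer_kernel_decay:
  assumes "\<bar>s\<bar> \<le> 4"
  shows "real (n + 1) * s\<^sup>2 * norm (fejer_kernel n s) \<le> 36"
proof -
  have "(\<bar>s / 2\<bar> / 3)\<^sup>2 \<le> \<bar>sin (s / 2)\<bar>\<^sup>2"
    by (intro power_mono abs_sin_ge_third) (use assms in auto)
  then have "s\<^sup>2 \<le> 36 * (sin (s / 2))\<^sup>2"
    by (simp add: power_divide)
  then have "real (n + 1) * s\<^sup>2 * norm (fejer_kernel n s)
      \<le> real (n + 1) * (36 * (sin (s / 2))\<^sup>2) * norm (fejer_kernel n s)"
    by (intro mult_right_mono mult_left_mono) auto
  then show ?thesis
    using norm_fejer_kernel_sin_le[of n s] by (simp add: algebra_simps)
qed

text \<open>
  Shifting the kernel by \<open>\<theta> = O(1/n)\<close> preserves its decay as a function of the distance \<open>s\<close> to the old centre,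
  because \<open>s\<^sup>2 \<le> 2\<theta>\<^sup>2 + 2(\<theta> - s)\<^sup>2\<close>: the first term is controlled by the trivial bound \<open>n + 1\<close> on the
  kernel, the second by the decay of the unshifted kernel.
\<close>

lemma norm_fejer_kernel_translate:
  assumes \<theta>: "real (n + 1) * \<bar>\<theta>\<bar> \<le> A" and "\<bar>\<theta> - s\<bar> \<le> 4"
  shows "real (n + 1) * s\<^sup>2 * norm (fejer_kernel n (\<theta> - s)) \<le> 2 * A\<^sup>2 + 72"
proof -
  let ?N = "real (n + 1)" and ?F = "norm (fejer_kernel n (\<theta> - s))"
  have "s\<^sup>2 \<le> 2 * \<theta>\<^sup>2 + 2 * (\<theta> - s)\<^sup>2"
    using zero_le_power2[of "2 * \<theta> - s"] by (simp add: power2_eq_square algebra_simps)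
  then have "?N * s\<^sup>2 * ?F \<le> ?N * (2 * \<theta>\<^sup>2 + 2 * (\<theta> - s)\<^sup>2) * ?F"
    by (intro mult_right_mono mult_left_mono) auto
  also have "\<dots> = 2 * (?N * \<theta>\<^sup>2 * ?F) + 2 * (?N * (\<theta> - s)\<^sup>2 * ?F)"
    by (simp add: algebra_simps)
  also have "?N * \<theta>\<^sup>2 * ?F \<le> ?N * \<theta>\<^sup>2 * ?N"
    by (intro mult_left_mono norm_fejer_kernel_le) auto
  also have "\<dots> = (?N * \<bar>\<theta>\<bar>)\<^sup>2"
    by (simp add: power2_eq_square)
  also have "\<dots> \<le> A\<^sup>2"
    using \<theta> by (intro power_mono) auto
  also have "?N * (\<theta> - s)\<^sup>2 * ?F \<le> 36"
    by (rule norm_fejer_kernel_decay[OF assms(2)])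
  finally show ?thesis by simp
qed

section \<open>Dyadic domination of kernels\<close>

lemma dyadic_scale_exists:
  fixes a :: real
  assumes "1 \<le> a"
  shows "\<exists>J::nat. a \<le> 2 ^ J \<and> 2 ^ J \<le> 2 * a"
proof -
  define J where "J = (LEAST J::nat. a \<le> 2 ^ J)"
  have "\<exists>J::nat. a \<le> 2 ^ J"
    using real_arch_pow[of 2 a] less_imp_le by auto
  then have J: "a \<le> 2 ^ J"
    unfolding J_def by (rule LeastI_ex)
  have "2 ^ J \<le> 2 * a"
  proof (cases J)
    case (Suc i)
    then have "\<not> a \<le> 2 ^ i"
      using not_less_Least[of i "\<lambda>J. a \<le> 2 ^ J"] by (simp add: J_def)
    then show ?thesis using Suc by simp
  qed (use assms in auto)
  with J show ?thesis by blast
qed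

text \<open>
  For \<open>\<bar>s\<bar> \<le> 1/N\<close> the bound on \<open>k\<close> is \<open>NC\<close> and \<open>j = 0\<close> works. Otherwise the least \<open>j\<close> with
  \<open>\<bar>s\<bar> \<le> 2\<^sup>j/N\<close> works, since \<open>2\<^sup>j/(2N) < \<bar>s\<bar>\<close> turns \<open>C/(N s\<^sup>2)\<close> into \<open>4CN/4\<^sup>j\<close>.
\<close>

lemma dyadic_kernel_bound:
  fixes N k s :: real
  assumes N: "N > 0" and k: "0 \<le> k" "k \<le> N * C" "N * s\<^sup>2 * k \<le> C"
    and s: "\<bar>s\<bar> \<le> 2 ^ J / N"
  shows "\<exists>j\<le>J. \<bar>s\<bar> \<le> 2 ^ j / N \<and> k \<le> 4 * C * N / 4 ^ j"
  using s
proof (induction J)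
  case 0
  have "k \<le> 4 * (N * C)" using k(1,2) by linarith
  then have "k \<le> 4 * C * N" by (simp add: mult_ac)
  then show ?case using 0 by auto
next
  case (Suc J)
  show ?case
  proof (cases "\<bar>s\<bar> \<le> 2 ^ J / N")
    case True
    then show ?thesis using Suc.IH le_SucI by blast
  next
    case False
    then have "(2 ^ J / N)\<^sup>2 \<le> \<bar>s\<bar>\<^sup>2"
      using N by (intro power_mono) auto
    then have "N * (2 ^ J / N)\<^sup>2 * k \<le> N * s\<^sup>2 * k"
      using N k by (intro mult_right_mono mult_left_mono) auto
    also have "\<dots> \<le> C" by (rule k)
    finally have "k \<le> 4 * C * N / 4 ^ Suc J"
      using N by (simp add: field_simps power2_eq_square flip: power_mult_distrib)
    then show ?thesis using Suc.prems by blast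
  qed
qed

text \<open>
  A pointwise domination of a kernel value \<open>k\<close> at distance \<open>\<bar>s\<bar>\<close> from the centre by a combination of
  indicators of centred intervals, the only functions against which the Lebesgue point condition can be
  integrated directly. The last summand covers the points beyond the largest interval.
\<close>

lemma dyadic_majorant:
  fixes N k s :: real
  assumes N: "N > 0" and k: "0 \<le> k" "k \<le> N * C" "N * s\<^sup>2 * k \<le> C"
    and \<delta>: "0 < \<delta>" "\<delta> \<le> 2 ^ J / N"
  shows "k \<le> (\<Sum>j\<le>J. 4 * C * N / 4 ^ j * (if \<bar>s\<bar> \<le> 2 ^ j / N then 1 else 0)) + C / (N * \<delta>\<^sup>2)"
proof -
  have "0 \<le> N * C" using k by linarith
  then have C: "0 \<le> C" using N by (simp add: zero_le_mult_iff)
  let ?a = "\<lambda>j. 4 * C * N / 4 ^ j * (if \<bar>s\<bar> \<le> 2 ^ j / N then 1 else 0)"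
  have pos: "0 \<le> ?a j" for j using C N by simp
  show ?thesis
  proof (cases "\<bar>s\<bar> \<le> 2 ^ J / N")
    case True
    then obtain j where j: "j \<le> J" "\<bar>s\<bar> \<le> 2 ^ j / N" "k \<le> 4 * C * N / 4 ^ j"
      using dyadic_kernel_bound[OF N k] by blast
    then have "k \<le> ?a j" by simp
    also have "\<dots> \<le> (\<Sum>j\<le>J. ?a j)"
      by (rule member_le_sum) (use j pos in auto)
    also have "\<dots> \<le> (\<Sum>j\<le>J. ?a j) + C / (N * \<delta>\<^sup>2)"
      using C N by simp
    finally show ?thesis .
  next
    case False
    then have "\<delta>\<^sup>2 \<le> \<bar>s\<bar>\<^sup>2"
      using \<delta> by (intro power_mono) auto
    then have "N * \<delta>\<^sup>2 * k \<le> N * s\<^sup>2 * k"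
      using N k by (intro mult_right_mono mult_left_mono) auto
    then have "N * \<delta>\<^sup>2 * k \<le> C"
      using k(3) by linarith
    then have "k \<le> C / (N * \<delta>\<^sup>2)"
      using N \<delta> by (simp add: field_simps)
    then show ?thesis using sum_nonneg[of "{..J}" ?a] pos by simp
  qed
qed

lemma sum_half_powers_le: "(\<Sum>j\<le>J. 1 / 2 ^ j :: real) \<le> 2"
proof -
  have "(\<Sum>j\<le>J. 1 / 2 ^ j :: real) = 2 - 1 / 2 ^ J"
    by (induction J) (auto simp: field_simps)
  then show ?thesis by simp
qed

text \<open>
  The quantitative core of the argument. The scales \<open>2\<^sup>j/N\<close>, \<open>j \<le> J\<close>, must reach \<open>\<delta>\<close>, so that the remaining
  part of the kernel is of order \<open>1/(N\<delta>\<^sup>2)\<close>, but must stay below \<open>2\<delta>\<close>, where the smallness of the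
  integral means of \<open>\<bar>h\<bar>\<close> is known.
\<close>

lemma integral_dyadic_kernel_le:
  fixes h K :: "real \<Rightarrow> complex"
  assumes h: "h absolutely_integrable_on {x - r..x + r}"
    and hK: "(\<lambda>t. h t * K t) integrable_on {x - r..x + r}"
    and N: "N > 0" and \<delta>: "1 \<le> N * \<delta>" "2 * \<delta> \<le> r" and \<epsilon>: "0 \<le> \<epsilon>"
    and small: "\<And>\<rho>. 0 < \<rho> \<Longrightarrow> \<rho> \<le> 2 * \<delta> \<Longrightarrow> integral {x - \<rho>..x + \<rho>} (\<lambda>t. norm (h t)) \<le> \<epsilon> * \<rho>"
    and K: "\<And>t. t \<in> {x - r..x + r} \<Longrightarrow> norm (K t) \<le> N * C"
      "\<And>t. t \<in> {x - r..x + r} \<Longrightarrow> N * (t - x)\<^sup>2 * norm (K t) \<le> C"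
  shows "norm (integral {x - r..x + r} (\<lambda>t. h t * K t))
    \<le> 8 * C * \<epsilon> + C / (N * \<delta>\<^sup>2) * integral {x - r..x + r} (\<lambda>t. norm (h t))"
proof -
  have \<delta>0: "0 < \<delta>" using \<delta>(1) N
    by (metis less_le_trans zero_less_mult_pos zero_less_one)
  have C: "0 \<le> C"
    using order_trans[OF _ K(2)[of x]] \<delta>(2) \<delta>0 by simp
  obtain J where J: "N * \<delta> \<le> 2 ^ J" "2 ^ J \<le> 2 * (N * \<delta>)"
    using dyadic_scale_exists[OF \<delta>(1)] by blast
  define \<rho> where "\<rho> j = 2 ^ j / N" for j :: nat
  have \<rho>0: "0 < \<rho> j" for j using N by (simp add: \<rho>_def)
  have \<rho>\<delta>: "\<rho> j \<le> 2 * \<delta>" if "j \<le> J" for j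
  proof -
    have "(2::real) ^ j \<le> 2 ^ J" using that by simp
    then have "2 ^ j \<le> 2 * (N * \<delta>)" using J by linarith
    then show ?thesis using N by (simp add: \<rho>_def field_simps)
  qed
  let ?S = "{x - r..x + r}" and ?B = "\<lambda>j. {x - \<rho> j..x + \<rho> j}"
  let ?n = "\<lambda>t. norm (h t)"
  let ?M = "\<lambda>t. (\<Sum>j\<le>J. 4 * C * N / 4 ^ j * (if t \<in> ?B j then ?n t else 0)) + C / (N * \<delta>\<^sup>2) * ?n t"
  have n: "?n integrable_on ?S"
    using h by (simp add: absolutely_integrable_on_def)
  have sub: "?B j \<subseteq> ?S" if "j \<le> J" for j
    using \<rho>\<delta>[OF that] \<delta>(2) by auto
  have nB: "(\<lambda>t. if t \<in> ?B j then ?n t else 0) integrable_on ?S" if "j \<le> J" for j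
  proof -
    have "?n integrable_on ?B j"
      using n sub[OF that] by (rule integrable_on_subinterval)
    then show ?thesis
      using integrable_restrict_Int[of "?B j" ?n ?S] unfolding Int_absorb2[OF sub[OF that]] by blast
  qed
  have nB_eq: "integral ?S (\<lambda>t. if t \<in> ?B j then ?n t else 0) = integral (?B j) ?n" if "j \<le> J" for j
    using Henstock_Kurzweil_Integration.integral_restrict_Int[of ?S "?B j" ?n]
    unfolding Int_absorb2[OF sub[OF that]] .
  have M: "norm (h t * K t) \<le> ?M t" if "t \<in> ?S" for t
  proof -
    have "norm (K t) \<le> (\<Sum>j\<le>J. 4 * C * N / 4 ^ j * (if \<bar>t - x\<bar> \<le> 2 ^ j / N then 1 else 0)) + C / (N * \<delta>\<^sup>2)"
      by (rule dyadic_majorant[OF N _ K(1)[OF that] K(2)[OF that] \<delta>0])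
         (use J N in \<open>auto simp: field_simps\<close>)
    then have "?n t * norm (K t) \<le> ?n t * ((\<Sum>j\<le>J. 4 * C * N / 4 ^ j * (if \<bar>t - x\<bar> \<le> 2 ^ j / N then 1 else 0)) + C / (N * \<delta>\<^sup>2))"
      by (rule mult_left_mono) simp
    also have "\<dots> = ?M t"
      unfolding distrib_left sum_distrib_left
      by (intro arg_cong2[where f="(+)"] sum.cong) (auto simp: \<rho>_def abs_le_iff)
    finally show ?thesis by (simp add: norm_mult)
  qed
  have int: "integral ?S ?M = (\<Sum>j\<le>J. 4 * C * N / 4 ^ j * integral (?B j) ?n) + C / (N * \<delta>\<^sup>2) * integral ?S ?n"
  proof -
    have "integral ?S ?M = integral ?S (\<lambda>t. \<Sum>j\<le>J. 4 * C * N / 4 ^ j * (if t \<in> ?B j then ?n t else 0))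
        + integral ?S (\<lambda>t. C / (N * \<delta>\<^sup>2) * ?n t)"
      by (intro Henstock_Kurzweil_Integration.integral_add integrable_sum integrable_on_mult_right nB n) auto
    also have "integral ?S (\<lambda>t. \<Sum>j\<le>J. 4 * C * N / 4 ^ j * (if t \<in> ?B j then ?n t else 0))
        = (\<Sum>j\<le>J. integral ?S (\<lambda>t. 4 * C * N / 4 ^ j * (if t \<in> ?B j then ?n t else 0)))"
      by (intro Henstock_Kurzweil_Integration.integral_sum integrable_on_mult_right nB) auto
    also have "\<dots> = (\<Sum>j\<le>J. 4 * C * N / 4 ^ j * integral (?B j) ?n)"
      by (intro sum.cong refl)
         (simp only: Henstock_Kurzweil_Integration.integral_mult_right nB_eq atMost_iff)
    finally show ?thesis by simp
  qed
  have "norm (integral ?S (\<lambda>t. h t * K t)) \<le> integral ?S ?M"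
    by (intro integral_norm_bound_integral hK M integrable_add integrable_sum
        integrable_on_mult_right nB n) auto
  also note int
  also have "(\<Sum>j\<le>J. 4 * C * N / 4 ^ j * integral (?B j) ?n) \<le> (\<Sum>j\<le>J. 4 * C * \<epsilon> * (1 / 2 ^ j))"
  proof (rule sum_mono)
    fix j assume "j \<in> {..J}"
    then have "integral (?B j) ?n \<le> \<epsilon> * \<rho> j"
      using small[OF \<rho>0 \<rho>\<delta>] by simp
    then have "4 * C * N / 4 ^ j * integral (?B j) ?n \<le> 4 * C * N / 4 ^ j * (\<epsilon> * \<rho> j)"
      using C N by (intro mult_left_mono) auto
    also have "\<dots> = 4 * C * \<epsilon> * (1 / 2 ^ j)"
      using N by (simp add: \<rho>_def field_simps flip: power_mult_distrib)
    finally show "4 * C * N / 4 ^ j * integral (?B j) ?n \<le> 4 * C * \<epsilon> * (1 / 2 ^ j)" .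
  qed
  also have "\<dots> = 4 * C * \<epsilon> * (\<Sum>j\<le>J. 1 / 2 ^ j)"
    by (simp add: sum_distrib_left)
  also have "\<dots> \<le> 4 * C * \<epsilon> * 2"
    using C \<epsilon> by (intro mult_left_mono sum_half_powers_le) auto
  finally show ?thesis by simp
qed

text \<open>
  The estimate of the kernels is the domination by \<open>C min(N, 1/(N s\<^sup>2))\<close>, which a kernel with a
  displaced peak satisfies as well. First \<open>\<delta>\<close> is chosen to make the part near \<open>x\<close> small for all large \<open>N\<close>;
  then \<open>N \<rightarrow> \<infinity>\<close> disposes of the rest.
\<close>

lemma tendsto_integral_kernel:
  fixes h :: "real \<Rightarrow> complex" and K :: "'i \<Rightarrow> real \<Rightarrow> complex" and N :: "'i \<Rightarrow> real"
  assumes h: "h absolutely_integrable_on {x - r..x + r}" and r: "0 < r"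
    and mean: "((\<lambda>\<rho>. integral {x - \<rho>..x + \<rho>} (\<lambda>t. norm (h t)) / \<rho>) \<longlongrightarrow> 0) (at_right 0)"
    and N: "filterlim N at_top F"
    and hK: "\<forall>\<^sub>F i in F. (\<lambda>t. h t * K i t) integrable_on {x - r..x + r}"
    and K: "\<forall>\<^sub>F i in F. \<forall>t\<in>{x - r..x + r}. norm (K i t) \<le> N i * C"
      "\<forall>\<^sub>F i in F. \<forall>t\<in>{x - r..x + r}. N i * (t - x)\<^sup>2 * norm (K i t) \<le> C"
  shows "((\<lambda>i. integral {x - r..x + r} (\<lambda>t. h t * K i t)) \<longlongrightarrow> 0) F"
proof (rule tendstoI)
  fix e :: real assume e: "0 < e"
  \<comment> \<open>The part near \<open>x\<close> contributes \<open>8C\<epsilon> \<le> e/2\<close>; the absolute value and the added 1 keep the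
    denominator positive.\<close>
  define \<epsilon> where "\<epsilon> = e / (16 * (\<bar>C\<bar> + 1))"
  have \<epsilon>: "0 < \<epsilon>" using e by (simp add: \<epsilon>_def)
  have "8 * C * \<epsilon> \<le> 8 * (\<bar>C\<bar> + 1) * \<epsilon>"
    using \<epsilon> by (intro mult_right_mono) auto
  also have "\<dots> = e / 2"
    by (simp add: \<epsilon>_def field_simps)
  finally have half: "8 * C * \<epsilon> \<le> e / 2" .
  have "\<forall>\<^sub>F \<rho> in at_right 0. integral {x - \<rho>..x + \<rho>} (\<lambda>t. norm (h t)) / \<rho> < \<epsilon>"
    using order_tendstoD(2)[OF mean \<epsilon>] .
  then obtain \<eta> where \<eta>: "0 < \<eta>"
    "\<And>\<rho>. 0 < \<rho> \<Longrightarrow> \<rho> < \<eta> \<Longrightarrow> integral {x - \<rho>..x + \<rho>} (\<lambda>t. norm (h t)) / \<rho> < \<epsilon>"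
    by (auto simp: eventually_at_right_field)
  \<comment> \<open>The dyadic scales go up to \<open>2\<delta>\<close>, which must lie below \<open>\<eta>\<close> and inside the interval of integration.\<close>
  define \<delta> where "\<delta> = min (\<eta> / 3) (r / 2)"
  have \<delta>: "0 < \<delta>" "2 * \<delta> < \<eta>" "2 * \<delta> \<le> r"
    using \<eta>(1) r by (auto simp: \<delta>_def)
  have small: "integral {x - \<rho>..x + \<rho>} (\<lambda>t. norm (h t)) \<le> \<epsilon> * \<rho>" if "0 < \<rho>" "\<rho> \<le> 2 * \<delta>" for \<rho>
    using \<eta>(2)[of \<rho>] that \<delta>(2) by (simp add: divide_less_eq)
  let ?G = "integral {x - r..x + r} (\<lambda>t. norm (h t))"
  have "((\<lambda>i. C / \<delta>\<^sup>2 * ?G * inverse (N i)) \<longlongrightarrow> 0) F"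
    by (intro tendsto_mult_right_zero filterlim_compose[OF tendsto_inverse_0_at_top N] filterlim_ident)
  then have far: "\<forall>\<^sub>F i in F. C / \<delta>\<^sup>2 * ?G * inverse (N i) < e / 2"
    by (rule order_tendstoD) (use e in simp)
  have large: "\<forall>\<^sub>F i in F. max 1 (1 / \<delta>) \<le> N i"
    using N filterlim_at_top by blast
  show "\<forall>\<^sub>F i in F. dist (integral {x - r..x + r} (\<lambda>t. h t * K i t)) 0 < e"
    using far large hK K
  proof eventually_elim
    case (elim i)
    have "norm (integral {x - r..x + r} (\<lambda>t. h t * K i t)) \<le> 8 * C * \<epsilon> + C / (N i * \<delta>\<^sup>2) * ?G"
      by (rule integral_dyadic_kernel_le[OF h _ _ _ \<delta>(3) _ small])
         (use elim \<epsilon> \<delta>(1) in \<open>auto simp: field_simps\<close>)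
    also have "C / (N i * \<delta>\<^sup>2) * ?G = C / \<delta>\<^sup>2 * ?G * inverse (N i)"
      by (simp add: field_simps)
    also have "8 * C * \<epsilon> + \<dots> < e"
      using elim(1) half by linarith
    finally show ?case by simp
  qed
qed

section \<open>Fejer means as integrals against the kernel\<close>

lemma absolutely_integrable_on_mult_continuous:
  fixes f k :: "real \<Rightarrow> complex"
  assumes f: "f absolutely_integrable_on {a..b}" and k: "continuous_on {a..b} k"
  shows "(\<lambda>t. f t * k t) absolutely_integrable_on {a..b}"
proof -
  have "(\<lambda>t. k t * f t) absolutely_integrable_on {a..b}"
  proof (rule absolutely_integrable_bounded_measurable_product[OF bilinear_times _ _ _ f])
    show "k \<in> borel_measurable (lebesgue_on {a..b})"
      by (rule continuous_imp_measurable_on_sets_lebesgue[OF k]) simp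
    show "bounded (k ` {a..b})"
      by (intro compact_imp_bounded compact_continuous_image k) simp
  qed simp
  then show ?thesis by (simp add: mult.commute)
qed

lemma cis_of_int_mult_periodic: "cis (of_int k * (x + 2 * pi)) = cis (of_int k * x)"
proof -
  have "cis (of_int k * (x + 2 * pi)) = cis (of_int k * x) * cis (2 * pi * of_int k)"
    by (simp add: cis_mult algebra_simps)
  then show ?thesis by (simp only: cis_multiple_2pi[OF Ints_of_int] mult_1_right)
qed

lemma continuous_on_fejer_kernel [continuous_intros]:
  "continuous_on S g \<Longrightarrow> continuous_on S (\<lambda>t. fejer_kernel n (g t))"
  unfolding fejer_kernel_def
  by (intro continuous_intros ballI) (simp_all del: of_nat_add of_nat_Suc)

lemma L1_torus_absolutely_integrable:
  assumes "f \<in> L1_torus"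
  shows "f absolutely_integrable_on {a..b}"
  using assms absolutely_integrable_on_periodic[of f "2 * pi" "- pi" a b]
  by (simp add: L1_torus_def)

text \<open>
  By periodicity, the integral over \<open>[-\<pi>, \<pi>]\<close> that defines the coefficient may be taken over any period, in
  particular over one centred at a Lebesgue point.
\<close>

lemma fourier_coeff_mult_cis:
  assumes f: "f \<in> L1_torus"
  shows "fourier_coeff f k * cis (of_int k * y) =
    (1 / (2 * pi)) *\<^sub>R integral {a..a + 2 * pi} (\<lambda>t. f t * cis (of_int k * (y - t)))"
proof -
  let ?g = "\<lambda>t. f t * cis (- (of_int k * t))"
  have g: "?g absolutely_integrable_on {- pi..pi}"
    by (intro absolutely_integrable_on_mult_continuous L1_torus_absolutely_integrable[OF f] continuous_intros)
  have per: "?g (t + 2 * pi) = ?g t" for t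
    using f cis_of_int_mult_periodic[of "- k" t] by (simp add: L1_torus_def)
  have "(LINT t:{-pi..pi}|lebesgue. ?g t) = integral {- pi..pi} ?g"
    by (rule set_lebesgue_integral_eq_integral[OF g])
  also have "\<dots> = integral {a..a + 2 * pi} ?g"
    using integral_periodic[of ?g "2 * pi" "- pi" "- pi" a, OF per] g
    by (simp add: absolutely_integrable_on_def)
  finally have "fourier_coeff f k * cis (of_int k * y) =
      (1 / (2 * pi)) *\<^sub>R (integral {a..a + 2 * pi} ?g * cis (of_int k * y))"
    by (simp add: fourier_coeff_def)
  also have "integral {a..a + 2 * pi} ?g * cis (of_int k * y) =
      integral {a..a + 2 * pi} (\<lambda>t. ?g t * cis (of_int k * y))"
    by (rule Henstock_Kurzweil_Integration.integral_mult_left[symmetric])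
  also have "(\<lambda>t. ?g t * cis (of_int k * y)) = (\<lambda>t. f t * cis (of_int k * (y - t)))"
    by (simp add: mult.assoc cis_mult algebra_simps)
  finally show ?thesis .
qed

lemma fejer_mean_eq_integral:
  assumes f: "f \<in> L1_torus"
  shows "fejer_mean n y f =
    (1 / (2 * pi)) *\<^sub>R integral {a..a + 2 * pi} (\<lambda>t. f t * fejer_kernel n (y - t))"
proof -
  let ?I = "{a..a + 2 * pi}"
  let ?e = "\<lambda>j t. f t * cis (of_int j * (y - t))"
  have int: "?e j integrable_on ?I" for j
    by (intro set_lebesgue_integral_eq_integral(1) absolutely_integrable_on_mult_continuous
        L1_torus_absolutely_integrable[OF f] continuous_intros)
  have "(\<Sum>k=0..n. fourier_partial_sum f k y) =
      (1 / (2 * pi)) *\<^sub>R (\<Sum>k=0..n. \<Sum>j\<in>{- int k..int k}. integral ?I (?e j))"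
    by (simp add: fourier_partial_sum_def fourier_coeff_mult_cis[OF f, of _ y a] scaleR_sum_right)
  also have "(\<Sum>k=0..n. \<Sum>j\<in>{- int k..int k}. integral ?I (?e j)) =
      integral ?I (\<lambda>t. \<Sum>k=0..n. \<Sum>j\<in>{- int k..int k}. ?e j t)"
    by (simp add: Henstock_Kurzweil_Integration.integral_sum integrable_sum int)
  also have "(\<lambda>t. \<Sum>k=0..n. \<Sum>j\<in>{- int k..int k}. ?e j t) =
      (\<lambda>t. f t * fejer_kernel n (y - t) * of_nat (n + 1))"
    by (simp add: fejer_kernel_def sum_distrib_left del: of_nat_Suc of_nat_add)
  also have "integral ?I \<dots> = integral ?I (\<lambda>t. f t * fejer_kernel n (y - t)) * of_nat (n + 1)"
    by (rule Henstock_Kurzweil_Integration.integral_mult_left)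
  finally show ?thesis
    by (simp add: fejer_mean_def scaleR_conv_of_real del: of_nat_Suc of_nat_add)
qed

lemma const_in_L1_torus: "(\<lambda>_. c) \<in> L1_torus"
  by (simp add: L1_torus_def absolutely_integrable_continuous_real)

lemma fourier_coeff_const: "fourier_coeff (\<lambda>_. c) k = (if k = 0 then c else 0)"
proof (cases "k = 0")
  case True
  have "fourier_coeff (\<lambda>_. c) 0 = (1 / (2 * pi)) *\<^sub>R integral {0..2 * pi} (\<lambda>t. c)"
    using fourier_coeff_mult_cis[OF const_in_L1_torus, of c 0 0 0] by simp
  then show ?thesis using True by (simp add: scaleR_conv_of_real)
next
  case False
  let ?F = "\<lambda>t. c * cis (- of_int k * t) / (- \<i> * of_int k)"
  have "((\<lambda>t. c * cis (- of_int k * t)) has_integral ?F (2 * pi) - ?F 0) {0..2 * pi}"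
    by (rule fundamental_theorem_of_calculus)
       (use False in \<open>auto intro!: derivative_eq_intros simp: has_vector_derivative_def fun_eq_iff
          scaleR_conv_of_real field_simps\<close>)
  moreover have "?F (2 * pi) = ?F 0"
    using cis_of_int_mult_periodic[of "- k" 0] by simp
  ultimately have "integral {0..2 * pi} (\<lambda>t. c * cis (- of_int k * t)) = 0"
    by (metis diff_self integral_unique)
  then show ?thesis
    using False fourier_coeff_mult_cis[OF const_in_L1_torus, of c k 0 0]
    by (simp del: Henstock_Kurzweil_Integration.integral_mult_right)
qed

text \<open>
  Through the integral representation of the Fejer means, this says that the Fejer kernel has mean value 1.
\<close>

lemma fejer_mean_const: "fejer_mean n y (\<lambda>_. c) = c"
proof -
  have "fourier_coeff (\<lambda>_. c) j * cis (of_int j * y) = (if j = 0 then c else 0)" for j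
    by (simp add: fourier_coeff_const)
  then have "fourier_partial_sum (\<lambda>_. c) k y = c" for k
    by (simp add: fourier_partial_sum_def)
  then show ?thesis
    by (simp add: fejer_mean_def del: of_nat_Suc of_nat_add)
qed

lemma fejer_mean_diff_eq_integral:
  assumes f: "f \<in> L1_torus"
  shows "fejer_mean n y f - c =
    (1 / (2 * pi)) *\<^sub>R integral {a..a + 2 * pi} (\<lambda>t. (f t - c) * fejer_kernel n (y - t))"
proof -
  have int: "(\<lambda>t. g t * fejer_kernel n (y - t)) integrable_on {a..a + 2 * pi}"
    if "g \<in> L1_torus" for g
    by (intro set_lebesgue_integral_eq_integral(1) absolutely_integrable_on_mult_continuous
        L1_torus_absolutely_integrable[OF that] continuous_intros)
  have "fejer_mean n y f - c = fejer_mean n y f - fejer_mean n y (\<lambda>_. c)"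
    by (simp add: fejer_mean_const)
  also have "\<dots> = (1 / (2 * pi)) *\<^sub>R integral {a..a + 2 * pi}
      (\<lambda>t. f t * fejer_kernel n (y - t) - c * fejer_kernel n (y - t))"
    unfolding fejer_mean_eq_integral[OF f, of n y a] fejer_mean_eq_integral[OF const_in_L1_torus, of n y c a]
    by (simp add: Henstock_Kurzweil_Integration.integral_diff[OF int[OF f] int[OF const_in_L1_torus]]
        scaleR_diff_right)
  finally show ?thesis by (simp add: left_diff_distrib)
qed

section \<open>Convergence at Lebesgue points\<close>

text \<open>
  The Lebesgue point condition in the form in which it is used: one-sided in the radius \<open>\<rho>\<close>, with Henstock-Kurzweil
  integrals over closed intervals, and with the harmless factor \<open>1/2\<close> removed.
\<close>

lemma lebesgue_point_integral:
  assumes "f \<in> L1_torus" "lebesgue_point f x"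
  shows "((\<lambda>\<rho>. integral {x - \<rho>..x + \<rho>} (\<lambda>t. norm (f t - f x)) / \<rho>) \<longlongrightarrow> 0) (at_right 0)"
proof -
  let ?g = "\<lambda>t. norm (f t - f x)"
  have g: "?g absolutely_integrable_on {a..b}" for a b
    using L1_torus_absolutely_integrable[OF assms(1)]
    by (intro absolutely_integrable_norm[unfolded o_def] set_integral_diff(1))
       (auto simp: absolutely_integrable_continuous_real)
  have "((\<lambda>h. 1 / (2 * h) * (LINT u=ereal (x - h)..ereal (x + h)|lebesgue. ?g u)) \<longlongrightarrow> 0) (at_right 0)"
    using assms(2) unfolding lebesgue_point_def by (rule tendsto_within_subset) simp
  from tendsto_mult_right_zero[OF this, of 2]
  have "((\<lambda>h. 2 * (1 / (2 * h) * (LINT u=ereal (x - h)..ereal (x + h)|lebesgue. ?g u))) \<longlongrightarrow> 0) (at_right 0)" .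
  moreover have "\<forall>\<^sub>F h in at_right 0. 2 * (1 / (2 * h) * (LINT u=ereal (x - h)..ereal (x + h)|lebesgue. ?g u))
      = integral {x - h..x + h} ?g / h"
    using eventually_at_right_less[of 0]
  proof eventually_elim
    case (elim h)
    have "(LINT u:{x - h<..<x + h}|lebesgue. ?g u) = integral {x - h<..<x + h} ?g"
      by (rule set_lebesgue_integral_eq_integral)
         (use g absolutely_integrable_on_Icc_iff_Ioo in blast)
    then show ?case using elim
      by (simp add: interval_lebesgue_integral_def integral_open_interval_real)
  qed
  ultimately show ?thesis by (rule Lim_transform_eventually)
qed

theorem corollary1p1:
  fixes f :: "real \<Rightarrow> complex" and \<theta> :: "nat \<Rightarrow> real" and x :: real
  assumes "f \<in> L1_torus"
    and "\<theta> \<in> O(\<lambda>n. 1 / real n)"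
    and "lebesgue_point f x"
  shows "(\<lambda>n. fejer_mean n (x + \<theta> n) f) \<longlonglongrightarrow> f x"
proof -
  obtain c where \<theta>c: "\<forall>\<^sub>F n in sequentially. norm (\<theta> n) \<le> c * norm (1 / real n)"
    using landau_o.bigE[OF assms(2)] by blast
  define C where "C = 2 * (2 * c)\<^sup>2 + 72"
  let ?I = "{x - pi..x + pi}"
  \<comment> \<open>The constant doubles because \<open>n + 1 \<le> 2n\<close> is used to pass from \<open>1/n\<close> to \<open>1/(n + 1)\<close>.\<close>
  have \<theta>: "\<forall>\<^sub>F n in sequentially. real (n + 1) * \<bar>\<theta> n\<bar> \<le> 2 * c"
    using \<theta>c eventually_ge_at_top[of 1]
  proof eventually_elim
    case (elim n)
    then have "real n * \<bar>\<theta> n\<bar> \<le> c" by (simp add: field_simps)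
    moreover have "real (n + 1) * \<bar>\<theta> n\<bar> \<le> (2 * real n) * \<bar>\<theta> n\<bar>"
      using elim by (intro mult_right_mono) auto
    ultimately show ?case by simp
  qed
  have "\<forall>\<^sub>F n in sequentially. 4 * c \<le> real n"
    using filterlim_real_sequentially by (simp add: filterlim_at_top)
  then have \<theta>_small: "\<forall>\<^sub>F n in sequentially. \<bar>\<theta> n\<bar> \<le> 1 / 2"
    using \<theta>
  proof eventually_elim
    case (elim n)
    have "real (n + 1) * \<bar>\<theta> n\<bar> \<le> 2 * c" by (rule elim)
    also have "\<dots> \<le> real (n + 1) * (1 / 2)" using elim(1) by simp
    finally show ?case
      by (subst (asm) mult_le_cancel_left_pos) auto
  qed
  have f: "f absolutely_integrable_on ?I"
    by (rule L1_torus_absolutely_integrable[OF assms(1)])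
  have h: "(\<lambda>t. f t - f x) absolutely_integrable_on ?I"
    by (intro set_integral_diff(1) f) (simp add: absolutely_integrable_continuous_real)
  have "(\<lambda>n. integral ?I (\<lambda>t. (f t - f x) * fejer_kernel n (x + \<theta> n - t))) \<longlonglongrightarrow> 0"
  proof (rule tendsto_integral_kernel[OF h pi_gt_zero lebesgue_point_integral[OF assms(1,3)],
        where N = "\<lambda>n. real (n + 1)" and C = C])
    show "filterlim (\<lambda>n. real (n + 1)) at_top sequentially"
      using filterlim_compose[OF filterlim_real_sequentially filterlim_Suc] by simp
    show "\<forall>\<^sub>F n in sequentially. (\<lambda>t. (f t - f x) * fejer_kernel n (x + \<theta> n - t)) integrable_on ?I"
      by (intro always_eventually allI set_lebesgue_integral_eq_integral(1)
          absolutely_integrable_on_mult_continuous h continuous_intros)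
    have "norm (fejer_kernel n s) \<le> real (n + 1) * C" for n s
    proof -
      have "norm (fejer_kernel n s) \<le> real (n + 1) * 1"
        using norm_fejer_kernel_le by simp
      also have "\<dots> \<le> real (n + 1) * C"
        by (intro mult_left_mono) (auto simp: C_def)
      finally show ?thesis .
    qed
    then show "\<forall>\<^sub>F n in sequentially. \<forall>t\<in>?I. norm (fejer_kernel n (x + \<theta> n - t)) \<le> real (n + 1) * C"
      by simp
    show "\<forall>\<^sub>F n in sequentially. \<forall>t\<in>?I.
        real (n + 1) * (t - x)\<^sup>2 * norm (fejer_kernel n (x + \<theta> n - t)) \<le> C"
      using \<theta> \<theta>_small
    proof eventually_elim
      case (elim n)
      show ?case
      proof
        fix t assume "t \<in> ?I"
        \<comment> \<open>This is where \<open>\<pi> + 1/2 \<le> 4\<close> is needed.\<close>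
        then have "\<bar>\<theta> n - (t - x)\<bar> \<le> 4"
          using elim(2) pi_approx(2) by (auto simp: abs_le_iff)
        from norm_fejer_kernel_translate[OF elim(1) this]
        show "real (n + 1) * (t - x)\<^sup>2 * norm (fejer_kernel n (x + \<theta> n - t)) \<le> C"
          by (simp add: C_def algebra_simps)
      qed
    qed
  qed
  then have "(\<lambda>n. (1 / (2 * pi)) *\<^sub>R integral ?I (\<lambda>t. (f t - f x) * fejer_kernel n (x + \<theta> n - t))) \<longlonglongrightarrow> 0"
    using tendsto_scaleR[OF tendsto_const] by fastforce
  moreover have "fejer_mean n y f - f x =
      (1 / (2 * pi)) *\<^sub>R integral ?I (\<lambda>t. (f t - f x) * fejer_kernel n (y - t))" for n y
    using fejer_mean_diff_eq_integral[OF assms(1), of n y "f x" "x - pi"] by (simp add: add.commute)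
  ultimately have "(\<lambda>n. fejer_mean n (x + \<theta> n) f - f x) \<longlonglongrightarrow> 0"
    by simp
  then show ?thesis
    by (simp add: LIM_zero_iff)
qed

end
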